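(* There is an absolute constant $p_0$ such that for every prime $p\ge p_0$ the following holds. Let $\Pi=\mathbb{F}_p\times\mathbb{F}_p$, and let $\mathbf{g}:\Pi\to\Pi$ be an invertible affine transformation such that $\mathbf{g}-I$ is also invertible, where $I$ is the identity map of $\Pi$. Then for any two-coloring of $\Pi$ and any $a\in\mathbb{F}_p$, $a\neq 0$, there is a monochromatic triple $\{x,y,z\}$ of the form $y=x+s$, $z=x+\mathbf{g}(s)$ with $x\in\Pi$ and $s\in\mathcal{S}_a$.
   Context: For $x=(x_1,x_2)\in\Pi=\mathbb{F}_p\times\mathbb{F}_p$ put $\|x\|:=x_1^2+x_2^2\in\mathbb{F}_p$, and for $a\ne 0$ let $\mathcal{S}_a=\{x\in\Pi:\|x\|=a\}$ (the sphere). A two-coloring of $\Pi$ is a partition of $\Pi$ into two disjoint sets (the colors); a triple is monochromatic if all its points belong to the same color. The map $\mathbf{g}-I$ is $x\mapsto\mathbf{g}(x)-x$. *)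

theory Defs
  imports "HOL-Number_Theory.Residues"
begin

text \<open>The prime is quantified inside the statement, so the field \<open>F_p\<close> is the library's
  \<^const>\<open>residue_ring\<close>, with carrier \<open>{0..p - 1}\<close>, rather than a type.\<close>

abbreviation GF :: "nat \<Rightarrow> int ring"
  where "GF p \<equiv> residue_ring (int p)"

definition plane :: "('a, 'b) ring_scheme \<Rightarrow> ('a \<times> 'a) set"
  where "plane R = carrier R \<times> carrier R"

definition plane_add :: "('a, 'b) ring_scheme \<Rightarrow> 'a \<times> 'a \<Rightarrow> 'a \<times> 'a \<Rightarrow> 'a \<times> 'a"
  where "plane_add R x y = (fst x \<oplus>\<^bsub>R\<^esub> fst y, snd x \<oplus>\<^bsub>R\<^esub> snd y)"

definition plane_minus :: "('a, 'b) ring_scheme \<Rightarrow> 'a \<times> 'a \<Rightarrow> 'a \<times> 'a \<Rightarrow> 'a \<times> 'a"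
  where "plane_minus R x y = (fst x \<ominus>\<^bsub>R\<^esub> fst y, snd x \<ominus>\<^bsub>R\<^esub> snd y)"

definition sq_norm :: "('a, 'b) ring_scheme \<Rightarrow> 'a \<times> 'a \<Rightarrow> 'a"
  where "sq_norm R x = fst x \<otimes>\<^bsub>R\<^esub> fst x \<oplus>\<^bsub>R\<^esub> snd x \<otimes>\<^bsub>R\<^esub> snd x"

definition plane_sphere :: "('a, 'b) ring_scheme \<Rightarrow> 'a \<Rightarrow> ('a \<times> 'a) set"
  where "plane_sphere R a = {x \<in> plane R. sq_norm R x = a}"

text \<open>A linear map followed by a translation. Only the values on \<open>plane R\<close> matter.\<close>

definition affine_map :: "('a, 'b) ring_scheme \<Rightarrow> ('a \<times> 'a \<Rightarrow> 'a \<times> 'a) \<Rightarrow> bool"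
  where "affine_map R g \<longleftrightarrow>
    (\<exists>m11\<in>carrier R. \<exists>m12\<in>carrier R. \<exists>m21\<in>carrier R. \<exists>m22\<in>carrier R. \<exists>v\<in>plane R.
      \<forall>x\<in>plane R. g x =
        plane_add R
          (m11 \<otimes>\<^bsub>R\<^esub> fst x \<oplus>\<^bsub>R\<^esub> m12 \<otimes>\<^bsub>R\<^esub> snd x,
           m21 \<otimes>\<^bsub>R\<^esub> fst x \<oplus>\<^bsub>R\<^esub> m22 \<otimes>\<^bsub>R\<^esub> snd x)
          v)"

definition invertible_on_plane :: "('a, 'b) ring_scheme \<Rightarrow> ('a \<times> 'a \<Rightarrow> 'a \<times> 'a) \<Rightarrow> bool"
  where "invertible_on_plane R g \<longleftrightarrow> bij_betw g (plane R) (plane R)"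

text \<open>A colour class may be empty.\<close>

definition two_coloring :: "'c set \<Rightarrow> 'c set \<Rightarrow> 'c set \<Rightarrow> bool"
  where "two_coloring X A B \<longleftrightarrow> A \<union> B = X \<and> A \<inter> B = {}"

definition monochromatic :: "'c set \<Rightarrow> 'c set \<Rightarrow> 'c set \<Rightarrow> bool"
  where "monochromatic A B T \<longleftrightarrow> T \<subseteq> A \<or> T \<subseteq> B"

end

theory Submission
  imports Defs "HOL-Library.Product_Plus" Complex_Main
begin

text \<open>
  Put \<open>f = 1\<close> on the first color and \<open>f = - 1\<close> on the second. A triple \<open>x, y, z\<close> fails to be
  monochromatic exactly when \<open>f x * f y + f x * f z + f y * f z = - 1\<close>, so the number of
  monochromatic triples is governed by correlations of \<open>f\<close> at \<^emph>\<open>pairs\<close> of points. This is why two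
  colors are within reach of a linear argument: each of the three pairs is, after a translation,
  of the form \<open>x, x + h s\<close> with \<open>s\<close> on the sphere and \<open>h\<close> one of the affine bijections \<open>I\<close>, \<open>g\<close>,
  \<open>g - I\<close>. If there were no monochromatic triple at all, the three correlations
  \<open>\<Sum>s x. f x * f (x + h s)\<close> would add up to \<open>- n * p\<^sup>2\<close>, where \<open>n\<close> is the size of the sphere.

  By Fourier inversion such a correlation is \<open>p\<^sup>-\<^sup>2\<close> times the sum over frequencies \<open>\<xi>\<close> of
  \<open>\<bar>F \<xi>\<bar>\<^sup>2\<close> times an exponential sum over \<open>h\<close> of the sphere. The frequency \<open>0\<close> contributes a
  nonnegative amount. Since \<open>h\<close> is a bijection, every other exponential sum is, up to a phase,
  the transform of the sphere itself at some nonzero frequency. If these transforms are at most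
  \<open>n / 4\<close> in absolute value, then each correlation is at least \<open>- n * p\<^sup>2 / 4\<close> by Plancherel,
  and three of them cannot reach \<open>- n * p\<^sup>2\<close> (lemmas \<open>correlation_lower_bound\<close> and
  \<open>monochromatic_triple\<close>).

  The bound on the transform of the sphere (lemma \<open>expsum_sphere_small\<close>) follows Kloosterman's
  fourth moment method. A line meets the sphere in at most two points, so the sphere has at most
  \<open>3 * n\<^sup>2\<close> additive quadruples and the fourth moment of its transform over all frequencies is at
  most \<open>3 * p\<^sup>2 * n\<^sup>2\<close>. The transform is invariant under rotations, and the rotation group, which
  is the unit sphere under multiplication of Gaussian integers modulo \<open>p\<close>, acts freely on nonzero
  frequencies. Hence each value at a nonzero frequency is repeated at least \<open>p - 2\<close> times, so its
  fourth power is at most \<open>3 * p\<^sup>2 * n\<^sup>2 / (p - 2)\<close>. As \<open>n\<close> is at least \<open>p - 2\<close>, this is below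
  \<open>(n / 4)^4\<close> for large \<open>p\<close>.
\<close>

section \<open>The plane of pairs of residues\<close>

text \<open>Points are pairs of integers: algebra takes place on arbitrary representatives, and \<open>red\<close>
  selects the one in the carrier. Identities over the field thereby become divisibility statements
  about integer polynomials.\<close>

locale prime_plane =
  fixes p :: nat
  assumes prime_p: "prime p" and p_gt_2: "2 < p"
begin

abbreviation q :: int where "q \<equiv> int p"

lemma prime_q: "prime q" using prime_p by simp

lemma q_dvd_mult_iff: "q dvd x * y \<longleftrightarrow> q dvd x \<or> q dvd y"
  using prime_q prime_dvd_mult_iff by blast

lemma not_dvd_2: "\<not> q dvd 2"
  using p_gt_2 zdvd_not_zless[of 2 q] by auto

definition P :: "(int \<times> int) set" where "P = {0..<q} \<times> {0..<q}"

definition red :: "int \<times> int \<Rightarrow> int \<times> int" where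
  "red x = (fst x mod q, snd x mod q)"

definition dot :: "int \<times> int \<Rightarrow> int \<times> int \<Rightarrow> int" where
  "dot x y = fst x * fst y + snd x * snd y"

lemma p_pos: "0 < p" using p_gt_2 by simp

lemma finite_P [simp]: "finite P" by (simp add: P_def)

lemma card_P: "card P = p ^ 2"
  by (simp add: P_def card_cartesian_product power2_eq_square)

lemma red_in_P [simp]: "red x \<in> P"
  using p_pos by (simp add: red_def P_def)

lemma red_id: "x \<in> P \<Longrightarrow> red x = x"
  by (auto simp: red_def P_def)

lemma red_red [simp]: "red (red x) = red x" by (simp add: red_id)

lemma red_eq_iff: "red x = red y \<longleftrightarrow> q dvd fst x - fst y \<and> q dvd snd x - snd y"
  by (simp add: red_def mod_eq_dvd_iff)

lemma red_eq_0_iff: "red x = 0 \<longleftrightarrow> q dvd fst x \<and> q dvd snd x"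
  by (simp add: red_def zero_prod_def dvd_eq_mod_eq_0)

lemma zero_in_P [simp]: "0 \<in> P" using p_pos by (simp add: P_def zero_prod_def)

lemma red_add: "red (red x + y) = red (x + y)" "red (x + red y) = red (x + y)"
  by (simp_all add: red_def mod_simps)
lemma red_diff: "red (red x - y) = red (x - y)" "red (x - red y) = red (x - y)"
  by (simp_all add: red_def mod_simps)

section \<open>Characters and the Fourier transform\<close>

definition e :: "int \<Rightarrow> complex" where
  "e k = cis (2 * pi * of_int k / of_nat p)"

lemma e_0 [simp]: "e 0 = 1" by (simp add: e_def)

lemma e_add: "e (k + l) = e k * e l"
  by (simp add: e_def cis_mult add_divide_distrib distrib_left)

lemma e_minus: "e (- k) = cnj (e k)"
  by (simp add: e_def cis_cnj)

lemma norm_e [simp]: "cmod (e k) = 1" by (simp add: e_def)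

lemma e_eq_1_iff: "e k = 1 \<longleftrightarrow> q dvd k"
proof
  assume "e k = 1"
  then have "cos (2 * pi * of_int k / of_nat p) = 1"
    by (metis cis.sel(1) e_def one_complex.sel(1))
  then obtain n :: int where "2 * pi * of_int k / of_nat p = of_int n * 2 * pi"
    using cos_one_2pi_int by auto
  then have "real_of_int k = of_int n * of_nat p"
    using p_pos by (simp add: field_simps)
  then have "real_of_int k = of_int (n * q)" by simp
  then have "k = n * q" using of_int_eq_iff by blast
  then show "q dvd k" by simp
next
  assume "q dvd k"
  then obtain n where "k = q * n" by auto
  then have "2 * pi * of_int k / of_nat p = 2 * pi * real_of_int n" using p_pos by simp
  then have "e k = cis (2 * pi * of_int n)" by (simp only: e_def)
  then show "e k = 1" using cis_multiple_2pi[OF Ints_of_int] by metis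
qed

lemma e_cong: "q dvd k - l \<Longrightarrow> e k = e l"
  using e_add[of "k - l" l] e_eq_1_iff[of "k - l"] by simp

lemma sum_e: "(\<Sum>k\<in>{0..<q}. e (k * m)) = (if q dvd m then of_nat p else 0)"
proof (cases "q dvd m")
  case True
  then have "e (k * m) = 1" for k by (simp add: e_eq_1_iff)
  then show ?thesis using True by simp
next
  case False
  have pow: "e (int j * m) = e m ^ j" for j
    by (induction j) (simp_all add: e_add distrib_right)
  have "(\<Sum>k\<in>{0..<q}. e (k * m)) = (\<Sum>j<p. e m ^ j)"
    unfolding pow[symmetric]
    by (rule sum.reindex_bij_witness[of _ int nat]) auto
  also have "\<dots> = 0"
  proof -
    have "e m ^ p = 1" by (simp add: pow[symmetric] e_eq_1_iff)
    moreover have "e m \<noteq> 1" using False by (simp add: e_eq_1_iff)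
    ultimately show ?thesis by (simp add: geometric_sum)
  qed
  finally show ?thesis using False by simp
qed

lemma dot_add: "dot x (y + z) = dot x y + dot x z"
  and dot_diff: "dot x (y - z) = dot x y - dot x z"
  by (simp_all add: dot_def algebra_simps)

lemma e_dot_red: "e (dot x (red y)) = e (dot x y)" "e (dot (red x) y) = e (dot x y)"
proof -
  have "q dvd (fst y mod q - fst y)" "q dvd (snd y mod q - snd y)"
    "q dvd (fst x mod q - fst x)" "q dvd (snd x mod q - snd x)"
    by (simp_all add: mod_eq_dvd_iff[symmetric])
  then have *: "q dvd fst x * (fst y mod q - fst y) + snd x * (snd y mod q - snd y)"
    "q dvd (fst x mod q - fst x) * fst y + (snd x mod q - snd x) * snd y"
    by simp_all
  show "e (dot x (red y)) = e (dot x y)" "e (dot (red x) y) = e (dot x y)"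
    by (rule e_cong; use * in \<open>simp add: dot_def red_def algebra_simps\<close>)+
qed

lemma sum_e_dot: "(\<Sum>\<xi>\<in>P. e (dot \<xi> x)) = (if red x = 0 then of_nat (p ^ 2) else 0)"
proof -
  have "(\<Sum>\<xi>\<in>P. e (dot \<xi> x)) = (\<Sum>k\<in>{0..<q}. e (k * fst x)) * (\<Sum>k\<in>{0..<q}. e (k * snd x))"
    by (simp add: P_def dot_def e_add sum_product sum.cartesian_product case_prod_unfold)
  then show ?thesis by (simp add: sum_e red_eq_0_iff power2_eq_square)
qed

definition fourier :: "(int \<times> int \<Rightarrow> real) \<Rightarrow> int \<times> int \<Rightarrow> complex" where
  "fourier f \<xi> = (\<Sum>x\<in>P. f x * e (dot \<xi> x))"

text \<open>Expanding the square turns the left side into a double sum of \<open>f x * f y\<close> against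
  \<open>\<Sum>\<xi>. e (dot \<xi> (x + w - y))\<close>, which vanishes unless \<open>y\<close> is the translate of \<open>x\<close> by \<open>w\<close>.\<close>

lemma autocorrelation:
  "(\<Sum>\<xi>\<in>P. of_real ((cmod (fourier f \<xi>))\<^sup>2) * e (dot \<xi> w)) =
    of_real ((real p)\<^sup>2 * (\<Sum>x\<in>P. f x * f (red (x + w))))"
proof -
  have "of_real ((cmod (fourier f \<xi>))\<^sup>2) * e (dot \<xi> w) =
      (\<Sum>x\<in>P. \<Sum>y\<in>P. of_real (f x * f y) * e (dot \<xi> (x + w - y)))" for \<xi>
  proof -
    have "of_real ((cmod (fourier f \<xi>))\<^sup>2) = fourier f \<xi> * cnj (fourier f \<xi>)"
      by (simp add: complex_norm_square del: of_real_power)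
    also have "\<dots> = (\<Sum>x\<in>P. \<Sum>y\<in>P. of_real (f x * f y) * (e (dot \<xi> x) * e (- dot \<xi> y)))"
      by (simp add: fourier_def sum_product e_minus mult_ac)
    finally show ?thesis
      by (simp add: sum_distrib_right sum_distrib_left dot_add dot_diff e_add[symmetric] mult.assoc)
         (simp add: algebra_simps)
  qed
  then have "(\<Sum>\<xi>\<in>P. of_real ((cmod (fourier f \<xi>))\<^sup>2) * e (dot \<xi> w)) =
     (\<Sum>\<xi>\<in>P. \<Sum>x\<in>P. \<Sum>y\<in>P. of_real (f x * f y) * e (dot \<xi> (x + w - y)))" by simp
  also have "\<dots> = (\<Sum>x\<in>P. \<Sum>\<xi>\<in>P. \<Sum>y\<in>P. of_real (f x * f y) * e (dot \<xi> (x + w - y)))"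
    by (rule sum.swap)
  also have "\<dots> = (\<Sum>x\<in>P. \<Sum>y\<in>P. \<Sum>\<xi>\<in>P. of_real (f x * f y) * e (dot \<xi> (x + w - y)))"
    by (intro sum.cong refl sum.swap)
  also have "\<dots> = (\<Sum>x\<in>P. \<Sum>y\<in>P. if y = red (x + w) then of_real (f x * f y * p ^ 2) else 0)"
  proof (intro sum.cong refl)
    fix x y assume "x \<in> P" "y \<in> P"
    have "red (x + w - y) = 0 \<longleftrightarrow> red (x + w) = red y"
      by (simp add: red_eq_0_iff red_eq_iff)
    also have "\<dots> \<longleftrightarrow> y = red (x + w)" using \<open>y \<in> P\<close> by (auto simp: red_id)
    finally show "(\<Sum>\<xi>\<in>P. of_real (f x * f y) * e (dot \<xi> (x + w - y))) =
        (if y = red (x + w) then of_real (f x * f y * p ^ 2) else 0)"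
      by (simp add: sum_distrib_left[symmetric] sum_e_dot)
  qed
  also have "\<dots> = (\<Sum>x\<in>P. of_real (f x * f (red (x + w)) * p ^ 2))"
    by (simp add: sum.delta)
  finally show ?thesis by (simp add: sum_distrib_left mult_ac)
qed

lemma plancherel: "(\<Sum>\<xi>\<in>P. (cmod (fourier f \<xi>))\<^sup>2) = (real p)\<^sup>2 * (\<Sum>x\<in>P. (f x)\<^sup>2)"
proof -
  have "complex_of_real (\<Sum>\<xi>\<in>P. (cmod (fourier f \<xi>))\<^sup>2) = of_real ((real p)\<^sup>2 * (\<Sum>x\<in>P. (f x)\<^sup>2))"
    using autocorrelation[of f 0]
    by (simp add: dot_def red_id power2_eq_square cong: sum.cong)
  then show ?thesis by (simp only: of_real_eq_iff)
qed

text \<open>The frequency \<open>0\<close> sees only the square of a real number and so helps the lower bound, however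
  unbalanced the coloring is; Plancherel controls the other frequencies.\<close>

lemma correlation_lower_bound:
  assumes "finite S" and M: "\<And>\<xi>. \<xi> \<in> P \<Longrightarrow> \<xi> \<noteq> 0 \<Longrightarrow> cmod (\<Sum>s\<in>S. e (dot \<xi> (h s))) \<le> M"
    and "0 \<le> M"
  shows "- M * (\<Sum>x\<in>P. (f x)\<^sup>2) \<le> (\<Sum>s\<in>S. \<Sum>x\<in>P. f x * f (red (x + h s)))"
proof -
  let ?E = "\<lambda>\<xi>. \<Sum>s\<in>S. e (dot \<xi> (h s))"
  let ?F = "\<lambda>\<xi>. (cmod (fourier f \<xi>))\<^sup>2"
  have "complex_of_real ((real p)\<^sup>2 * (\<Sum>s\<in>S. \<Sum>x\<in>P. f x * f (red (x + h s)))) =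
    (\<Sum>s\<in>S. of_real ((real p)\<^sup>2 * (\<Sum>x\<in>P. f x * f (red (x + h s)))))"
    by (simp only: sum_distrib_left of_real_sum)
  also have "\<dots> = (\<Sum>s\<in>S. \<Sum>\<xi>\<in>P. of_real (?F \<xi>) * e (dot \<xi> (h s)))"
    by (simp only: autocorrelation)
  also have "\<dots> = (\<Sum>\<xi>\<in>P. of_real (?F \<xi>) * ?E \<xi>)"
    by (subst sum.swap) (simp add: sum_distrib_left)
  finally have "Re (complex_of_real ((real p)\<^sup>2 * (\<Sum>s\<in>S. \<Sum>x\<in>P. f x * f (red (x + h s))))) =
    Re (\<Sum>\<xi>\<in>P. of_real (?F \<xi>) * ?E \<xi>)"
    by (rule arg_cong)
  then have "(real p)\<^sup>2 * (\<Sum>s\<in>S. \<Sum>x\<in>P. f x * f (red (x + h s))) =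
    Re (\<Sum>\<xi>\<in>P. of_real (?F \<xi>) * ?E \<xi>)"
    by (simp only: Re_complex_of_real)
  also have "\<dots> = (\<Sum>\<xi>\<in>P. ?F \<xi> * Re (?E \<xi>))" by simp
  finally have eq: "(real p)\<^sup>2 * (\<Sum>s\<in>S. \<Sum>x\<in>P. f x * f (red (x + h s))) =
    (\<Sum>\<xi>\<in>P. ?F \<xi> * Re (?E \<xi>))" .
  have "- M \<le> Re (?E \<xi>)" if "\<xi> \<in> P" for \<xi>
  proof (cases "\<xi> = 0")
    case True
    then show ?thesis using \<open>0 \<le> M\<close> by (simp add: dot_def)
  next
    case False
    then show ?thesis using M[OF that False] abs_Re_le_cmod[of "?E \<xi>"] by linarith
  qed
  then have "(\<Sum>\<xi>\<in>P. ?F \<xi> * - M) \<le> (\<Sum>\<xi>\<in>P. ?F \<xi> * Re (?E \<xi>))"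
    by (intro sum_mono mult_left_mono) auto
  then have "(real p)\<^sup>2 * (- M * (\<Sum>x\<in>P. (f x)\<^sup>2)) \<le> (real p)\<^sup>2 * (\<Sum>s\<in>S. \<Sum>x\<in>P. f x * f (red (x + h s)))"
    unfolding eq sum_distrib_right[symmetric] plancherel by (simp add: mult_ac)
  then show ?thesis by (rule mult_left_le_imp_le) (use p_pos in simp)
qed


section \<open>Gaussian integers modulo p and rotations\<close>

definition nrm :: "int \<times> int \<Rightarrow> int" where
  "nrm x = (fst x)\<^sup>2 + (snd x)\<^sup>2"

definition gmul :: "int \<times> int \<Rightarrow> int \<times> int \<Rightarrow> int \<times> int" where
  "gmul u x = (fst u * fst x - snd u * snd x, snd u * fst x + fst u * snd x)"

definition gcnj :: "int \<times> int \<Rightarrow> int \<times> int" where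
  "gcnj u = (fst u, - snd u)"

definition sphere :: "int \<Rightarrow> (int \<times> int) set" where
  "sphere a = {x \<in> P. q dvd nrm x - a}"

lemma finite_sphere [simp]: "finite (sphere a)" by (simp add: sphere_def)

lemma sphere_subset: "sphere a \<subseteq> P" by (auto simp: sphere_def)

lemma nrm_red: "q dvd nrm (red x) - nrm x"
proof -
  have "q dvd (fst x mod q - fst x)" "q dvd (snd x mod q - snd x)"
    by (simp_all add: mod_eq_dvd_iff[symmetric])
  then have "q dvd (fst x mod q - fst x) * (fst x mod q + fst x) +
     (snd x mod q - snd x) * (snd x mod q + snd x)" by simp
  then show ?thesis by (simp add: nrm_def red_def power2_eq_square algebra_simps)
qed

lemma red_in_sphere_iff: "red x \<in> sphere a \<longleftrightarrow> q dvd nrm x - a"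
  using dvd_add[OF nrm_red[of x], of "nrm x - a"] dvd_diff[of q "nrm (red x) - a", OF _ nrm_red[of x]]
  by (auto simp: sphere_def)

lemma nrm_gmul: "nrm (gmul u x) = nrm u * nrm x"
  by (simp add: nrm_def gmul_def power2_eq_square algebra_simps)

lemma dot_gmul: "dot (gmul u x) y = dot x (gmul (gcnj u) y)"
  by (simp add: dot_def gmul_def gcnj_def algebra_simps)

lemma gmul_in_sphere:
  assumes "u \<in> sphere 1" "x \<in> sphere a"
  shows "red (gmul u x) \<in> sphere a"
proof -
  have "q dvd nrm u - 1" "q dvd nrm x - a" using assms by (auto simp: sphere_def)
  then have "q dvd (nrm u - 1) * nrm x + (nrm x - a)" by simp
  then show ?thesis by (simp add: red_in_sphere_iff nrm_gmul algebra_simps)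
qed

text \<open>Nonzero vectors may be isotropic, so cancelling \<open>x\<close> only shows that \<open>u - v\<close> has norm zero.
  That \<open>u\<close> and \<open>v\<close> have norm \<open>1\<close> finishes the proof: then \<open>u\<close> times the conjugate of \<open>v\<close> has real part
  \<open>1\<close>, hence imaginary part \<open>0\<close>, and \<open>u = v\<close>.\<close>

lemma rotation_free:
  assumes u: "u \<in> sphere 1" and v: "v \<in> sphere 1" and x: "red x \<noteq> 0"
    and eq: "red (gmul u x) = red (gmul v x)"
  shows "u = v"
proof -
  obtain a b where [simp]: "u = (a, b)" by force
  obtain c d where [simp]: "v = (c, d)" by force
  obtain y z where [simp]: "x = (y, z)" by force
  have nu: "q dvd a\<^sup>2 + b\<^sup>2 - 1" and nv: "q dvd c\<^sup>2 + d\<^sup>2 - 1"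
    using u v by (auto simp: sphere_def nrm_def)
  have e1: "q dvd (a * y - b * z) - (c * y - d * z)" and e2: "q dvd (b * y + a * z) - (d * y + c * z)"
    using eq by (auto simp: gmul_def red_eq_iff)
  \<comment> \<open>Multiply \<open>(u - v) * x = 0\<close> by the conjugate of \<open>u - v\<close>.\<close>
  have "q dvd (a - c) * ((a * y - b * z) - (c * y - d * z)) + (b - d) * ((b * y + a * z) - (d * y + c * z))"
    using e1 e2 by simp
  then have "q dvd ((a - c)\<^sup>2 + (b - d)\<^sup>2) * y"
    by (simp add: power2_eq_square algebra_simps)
  moreover have "q dvd (a - c) * ((b * y + a * z) - (d * y + c * z)) - (b - d) * ((a * y - b * z) - (c * y - d * z))"
    using e1 e2 by simp
  then have "q dvd ((a - c)\<^sup>2 + (b - d)\<^sup>2) * z"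
    by (simp add: power2_eq_square algebra_simps)
  ultimately have uv: "q dvd (a - c)\<^sup>2 + (b - d)\<^sup>2"
    using x by (auto simp: q_dvd_mult_iff red_eq_0_iff)
  have "q dvd (a\<^sup>2 + b\<^sup>2 - 1) + (c\<^sup>2 + d\<^sup>2 - 1) - ((a - c)\<^sup>2 + (b - d)\<^sup>2)"
    using dvd_diff[OF dvd_add[OF nu nv] uv] .
  also have "\<dots> = 2 * (a * c + b * d - 1)"
    by (simp add: power2_eq_square algebra_simps)
  finally have ac: "q dvd a * c + b * d - 1"
    using not_dvd_2 q_dvd_mult_iff by blast
  have "q dvd (a\<^sup>2 + b\<^sup>2 - 1) * (c\<^sup>2 + d\<^sup>2) + (c\<^sup>2 + d\<^sup>2 - 1) - (a * c + b * d - 1) * (a * c + b * d + 1)"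
    using nu nv ac by simp
  also have "\<dots> = (b * c - a * d) * (b * c - a * d)"
    by (simp add: power2_eq_square algebra_simps)
  finally have bc: "q dvd b * c - a * d" by (simp add: q_dvd_mult_iff)
  \<comment> \<open>Recover \<open>u\<close> as \<open>v\<close> times the product of \<open>u\<close> with the conjugate of \<open>v\<close>.\<close>
  have "q dvd c * (a * c + b * d - 1) - d * (b * c - a * d) - a * (c\<^sup>2 + d\<^sup>2 - 1)"
    using nv ac bc by simp
  also have "\<dots> = a - c" by (simp add: power2_eq_square algebra_simps)
  finally have 1: "q dvd a - c" .
  have "q dvd d * (a * c + b * d - 1) + c * (b * c - a * d) - b * (c\<^sup>2 + d\<^sup>2 - 1)"
    using nv ac bc by simp
  also have "\<dots> = b - d" by (simp add: power2_eq_square algebra_simps)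
  finally have "red u = red v" using 1 by (simp add: red_eq_iff)
  then show ?thesis using u v sphere_subset by (metis red_id subsetD)
qed

section \<open>Lines meet spheres at most twice\<close>

lemma int_eq_if_dvd_diff: "x \<in> {0..<q} \<Longrightarrow> y \<in> {0..<q} \<Longrightarrow> q dvd x - y \<Longrightarrow> x = y"
  by (simp add: mod_eq_dvd_iff[symmetric])

lemma quadratic_roots_le_2:
  assumes "\<not> (q dvd A \<and> q dvd B \<and> q dvd C)"
  shows "card {y \<in> {0..<q}. q dvd A * y\<^sup>2 + B * y + C} \<le> 2"
proof (rule ccontr)
  assume "\<not> ?thesis"
  then obtain T where "T \<subseteq> {y \<in> {0..<q}. q dvd A * y\<^sup>2 + B * y + C}" "card T = 3"
    using obtain_subset_with_card_n[of 3 "{y \<in> {0..<q}. q dvd A * y\<^sup>2 + B * y + C}"] by auto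
  then obtain x y z where xyz: "x \<in> {0..<q}" "y \<in> {0..<q}" "z \<in> {0..<q}"
    and ne: "x \<noteq> y" "x \<noteq> z" "y \<noteq> z"
    and r: "q dvd A * x\<^sup>2 + B * x + C" "q dvd A * y\<^sup>2 + B * y + C" "q dvd A * z\<^sup>2 + B * z + C"
    by (auto simp: card_3_iff)
  have nd: "\<not> q dvd x - y" "\<not> q dvd x - z" "\<not> q dvd y - z"
    using ne xyz int_eq_if_dvd_diff by blast+
  have "q dvd (A * x\<^sup>2 + B * x + C) - (A * y\<^sup>2 + B * y + C)" using r dvd_diff by blast
  also have "\<dots> = (x - y) * (A * (x + y) + B)" by (simp add: power2_eq_square algebra_simps)
  finally have 1: "q dvd A * (x + y) + B" using nd by (simp add: q_dvd_mult_iff)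
  have "q dvd (A * x\<^sup>2 + B * x + C) - (A * z\<^sup>2 + B * z + C)" using r dvd_diff by blast
  also have "\<dots> = (x - z) * (A * (x + z) + B)" by (simp add: power2_eq_square algebra_simps)
  finally have 2: "q dvd A * (x + z) + B" using nd by (simp add: q_dvd_mult_iff)
  have "q dvd (A * (x + y) + B) - (A * (x + z) + B)" using 1 2 dvd_diff by blast
  also have "\<dots> = A * (y - z)" by (simp add: algebra_simps)
  finally have A: "q dvd A" using nd by (simp add: q_dvd_mult_iff)
  have "q dvd (A * (x + y) + B) - A * (x + y)" using 1 A by (intro dvd_diff) auto
  then have B: "q dvd B" by simp
  have "q dvd (A * x\<^sup>2 + B * x + C) - (A * x\<^sup>2 + B * x)" using r A B by (intro dvd_diff) auto
  then show False using A B assms by simp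
qed

text \<open>Solving the equation of the line for the first coordinate and substituting leaves a quadratic
  in the second. It does not degenerate: if \<open>d\<close> is isotropic and the linear coefficient vanishes
  too, then the constant coefficient is \<open>- a * (fst d)\<^sup>2\<close>, which is nonzero.\<close>

lemma card_graph_line_Int_sphere:
  assumes a: "\<not> q dvd a" and d: "\<not> q dvd fst d"
  shows "card {s \<in> sphere a. q dvd dot d s - c} \<le> 2"
proof -
  let ?L = "{s \<in> sphere a. q dvd dot d s - c}"
  let ?A = "(fst d)\<^sup>2 + (snd d)\<^sup>2" and ?B = "- 2 * c * snd d" and ?C = "c\<^sup>2 - a * (fst d)\<^sup>2"
  let ?R = "{y \<in> {0..<q}. q dvd ?A * y\<^sup>2 + ?B * y + ?C}"
  have "inj_on snd ?L"
  proof (rule inj_onI)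
    fix s t assume st: "s \<in> ?L" "t \<in> ?L" "snd s = snd t"
    then have "q dvd (dot d s - c) - (dot d t - c)" by (blast intro: dvd_diff)
    also have "\<dots> = fst d * (fst s - fst t)" using st by (simp add: dot_def algebra_simps)
    finally have "q dvd fst s - fst t" using d by (simp add: q_dvd_mult_iff)
    then have "fst s = fst t"
      using st int_eq_if_dvd_diff[of "fst s" "fst t"] by (auto simp: sphere_def P_def)
    then show "s = t" using st by (simp add: prod_eq_iff)
  qed
  moreover have "y \<in> ?R" if s: "(x, y) \<in> sphere a" "q dvd dot d (x, y) - c" for x y
  proof -
    from s have "q dvd (fst d)\<^sup>2 * (nrm (x, y) - a) - (dot d (x, y) - c) * (fst d * x - snd d * y + c)"
      by (auto simp: sphere_def)
    also have "\<dots> = ?A * y\<^sup>2 + ?B * y + ?C"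
      by (simp add: nrm_def dot_def power2_eq_square algebra_simps)
    finally show ?thesis using s by (auto simp: sphere_def P_def)
  qed
  then have "snd ` ?L \<subseteq> ?R" by auto
  moreover have "finite ?R" by (rule finite_subset[of _ "{0..<q}"]) auto
  ultimately have "card ?L \<le> card ?R"
    by (rule card_inj_on_le)
  also have "\<dots> \<le> 2"
  proof (rule quadratic_roots_le_2, safe)
    assume A: "q dvd ?A" and B: "q dvd ?B" and C: "q dvd ?C"
    have "\<not> q dvd c"
    proof
      assume "q dvd c"
      then have "q dvd c\<^sup>2" by (simp add: power2_eq_square)
      from dvd_diff[OF this C] have "q dvd a * (fst d)\<^sup>2" by simp
      then show False using a d by (simp add: q_dvd_mult_iff power2_eq_square)
    qed
    then have "q dvd snd d" using B not_dvd_2 by (simp add: q_dvd_mult_iff)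
    then have "q dvd (snd d)\<^sup>2" by (simp add: power2_eq_square)
    from dvd_diff[OF A this] show False using d by (simp add: q_dvd_mult_iff power2_eq_square)
  qed
  finally show ?thesis .
qed

lemma card_line_Int_sphere:
  assumes a: "\<not> q dvd a" and d: "red d \<noteq> 0"
  shows "card {s \<in> sphere a. q dvd dot d s - c} \<le> 2"
proof (cases "q dvd fst d")
  case False
  then show ?thesis using card_graph_line_Int_sphere a by blast
next
  case True
  then have "\<not> q dvd fst (prod.swap d)" using d by (simp add: red_eq_0_iff)
  from card_graph_line_Int_sphere[OF a this]
  have "card {s \<in> sphere a. q dvd dot (prod.swap d) s - c} \<le> 2" .
  also have "{s \<in> sphere a. q dvd dot (prod.swap d) s - c} = prod.swap ` {s \<in> sphere a. q dvd dot d s - c}"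
    by (auto simp: sphere_def P_def dot_def nrm_def add_ac image_iff)
  finally show ?thesis by (simp add: card_image)
qed

section \<open>The additive energy and the fourth moment of the sphere\<close>

definition diff_count :: "(int \<times> int) set \<Rightarrow> int \<times> int \<Rightarrow> nat" where
  "diff_count S d = card {z \<in> S \<times> S. red (fst z - snd z) = d}"

definition expsum :: "(int \<times> int) set \<Rightarrow> int \<times> int \<Rightarrow> complex" where
  "expsum S \<xi> = (\<Sum>s\<in>S. e (dot \<xi> s))"

lemma fourier_diff_count:
  assumes "finite S"
  shows "fourier (\<lambda>d. diff_count S d) \<xi> = (cmod (expsum S \<xi>))\<^sup>2"
proof -
  have "complex_of_real ((cmod (expsum S \<xi>))\<^sup>2) = expsum S \<xi> * cnj (expsum S \<xi>)"
    by (simp add: complex_norm_square del: of_real_power)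
  also have "\<dots> = (\<Sum>s\<in>S. \<Sum>t\<in>S. e (dot \<xi> (red (s - t))))"
    by (simp add: expsum_def sum_product e_minus[symmetric] e_add[symmetric] dot_diff e_dot_red)
  also have "\<dots> = (\<Sum>z\<in>S \<times> S. e (dot \<xi> (red (fst z - snd z))))"
    by (simp add: sum.cartesian_product case_prod_unfold)
  also have "\<dots> = (\<Sum>d\<in>P. \<Sum>z\<in>{z \<in> S \<times> S. red (fst z - snd z) = d}. e (dot \<xi> (red (fst z - snd z))))"
    using assms by (intro sum.group[symmetric]) auto
  also have "\<dots> = (\<Sum>d\<in>P. of_nat (diff_count S d) * e (dot \<xi> d))"
    by (simp add: diff_count_def)
  finally show ?thesis by (simp add: fourier_def)
qed

lemma sum_diff_count:
  assumes "finite S"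
  shows "(\<Sum>d\<in>P. diff_count S d) = (card S)\<^sup>2"
proof -
  have "(\<Sum>d\<in>P. card {z \<in> S \<times> S. red (fst z - snd z) = d}) = card (S \<times> S)"
    using assms sum.group[of "S \<times> S" P "\<lambda>z. red (fst z - snd z)" "\<lambda>_. 1 :: nat"]
    by (simp add: image_subset_iff)
  then show ?thesis by (simp add: diff_count_def card_cartesian_product power2_eq_square)
qed

lemma diff_count_0: "S \<subseteq> P \<Longrightarrow> diff_count S 0 = card S"
proof -
  assume S: "S \<subseteq> P"
  have "{z \<in> S \<times> S. red (fst z - snd z) = 0} = (\<lambda>s. (s, s)) ` S"
  proof -
    have "s = t" if "s \<in> S" "t \<in> S" "red (s - t) = 0" for s t
    proof -
      have "red s = red t" using that by (simp add: red_eq_0_iff red_eq_iff)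
      then show ?thesis using that S by (metis red_id subsetD)
    qed
    then have "z \<in> (\<lambda>s. (s, s)) ` S" if "z \<in> S \<times> S" "red (fst z - snd z) = 0" for z
    proof -
      obtain s t where z: "z = (s, t)" by (cases z)
      then have "s = t" using that \<open>\<And>t s. s \<in> S \<Longrightarrow> t \<in> S \<Longrightarrow> red (s - t) = 0 \<Longrightarrow> s = t\<close> by auto
      then show ?thesis using that z by auto
    qed
    then show ?thesis by (auto simp: red_id)
  qed
  then show ?thesis by (simp add: diff_count_def card_image inj_on_def)
qed

text \<open>Subtracting the equations of the sphere and of its translate by \<open>d\<close> leaves the equation of
  a line, so the first component of a pair with difference \<open>d\<close> lies on a line.\<close>

lemma diff_count_sphere_le:
  assumes a: "\<not> q dvd a" and d: "red d \<noteq> 0"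
  shows "diff_count (sphere a) d \<le> 2"
proof -
  let ?D = "{z \<in> sphere a \<times> sphere a. red (fst z - snd z) = d}"
  let ?L = "{s \<in> sphere a. q dvd dot (2 * fst d, 2 * snd d) s - nrm d}"
  have t: "t = red (s - d)" if "(s, t) \<in> ?D" for s t
  proof -
    have "d = red (s - t)" "t \<in> P" using that sphere_subset by auto
    then have "red (s - d) = red (s - (s - t))" by (simp only: red_diff)
    also have "\<dots> = t" using \<open>t \<in> P\<close> by (simp add: red_id)
    finally show ?thesis ..
  qed
  have "inj_on fst ?D"
  proof (rule inj_onI)
    fix y z assume yz: "y \<in> ?D" "z \<in> ?D" "fst y = fst z"
    then have "snd y = red (fst y - d)" "snd z = red (fst z - d)"
      using t[of "fst y" "snd y"] t[of "fst z" "snd z"] by (simp_all add: mem_Times_iff)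
    then show "y = z" using yz(3) by (intro prod_eqI) simp_all
  qed
  moreover have "fst z \<in> ?L" if "z \<in> ?D" for z
  proof -
    obtain s1 s2 t1 t2 where z: "z = ((s1, s2), (t1, t2))" by (metis prod.exhaust)
    then have D: "(s1, s2) \<in> sphere a" "(t1, t2) \<in> sphere a" "d = red ((s1, s2) - (t1, t2))"
      using that by auto
    have "red ((s1, s2) - d) = (t1, t2)"
      using t[of "(s1, s2)" "(t1, t2)"] D(1,2) D(3)[symmetric] by simp
    moreover have "(s1, s2) - d = (s1 - fst d, s2 - snd d)" by (simp add: prod_eq_iff)
    ultimately have "red (s1 - fst d, s2 - snd d) = (t1, t2)" by simp
    then have "q dvd nrm (s1 - fst d, s2 - snd d) - a"
      using D red_in_sphere_iff[of "(s1 - fst d, s2 - snd d)"] by simp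
    moreover have "q dvd nrm (s1, s2) - a" using D by (auto simp: sphere_def)
    ultimately have "q dvd (nrm (s1, s2) - a) - (nrm (s1 - fst d, s2 - snd d) - a)" by (rule dvd_diff[rotated])
    also have "\<dots> = dot (2 * fst d, 2 * snd d) (s1, s2) - nrm d"
      by (simp add: nrm_def dot_def power2_eq_square algebra_simps)
    finally show ?thesis using D by (simp add: z)
  qed
  then have "fst ` ?D \<subseteq> ?L" by blast
  ultimately have "card ?D \<le> card ?L" by (intro card_inj_on_le) auto
  also have "\<dots> \<le> 2"
    using d not_dvd_2 by (intro card_line_Int_sphere[OF a]) (auto simp: red_eq_0_iff q_dvd_mult_iff)
  finally show ?thesis by (simp add: diff_count_def)
qed

lemma energy_sphere:
  assumes a: "\<not> q dvd a"
  shows "(\<Sum>d\<in>P. (diff_count (sphere a) d)\<^sup>2) \<le> 3 * (card (sphere a))\<^sup>2"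
proof -
  let ?r = "diff_count (sphere a)" and ?n = "card (sphere a)"
  have "(\<Sum>d\<in>P. (?r d)\<^sup>2) = (?r 0)\<^sup>2 + (\<Sum>d\<in>P - {0}. (?r d)\<^sup>2)"
    by (rule sum.remove[OF finite_P zero_in_P])
  also have "(\<Sum>d\<in>P - {0}. (?r d)\<^sup>2) \<le> (\<Sum>d\<in>P - {0}. 2 * ?r d)"
    using diff_count_sphere_le[OF a] by (intro sum_mono) (auto simp: power2_eq_square red_id)
  also have "(\<Sum>d\<in>P - {0}. 2 * ?r d) \<le> 2 * (\<Sum>d\<in>P. ?r d)"
    unfolding sum_distrib_left by (intro sum_mono2) auto
  finally show ?thesis by (simp add: diff_count_0 sphere_subset sum_diff_count)
qed

text \<open>Plancherel for the function \<open>diff_count\<close>, whose transform is the squared absolute value of the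
  exponential sum.\<close>

lemma fourth_moment:
  assumes a: "\<not> q dvd a"
  shows "(\<Sum>\<xi>\<in>P. (cmod (expsum (sphere a) \<xi>)) ^ 4) \<le> 3 * p ^ 2 * (card (sphere a))\<^sup>2"
proof -
  have "(\<Sum>\<xi>\<in>P. (cmod (expsum (sphere a) \<xi>)) ^ 4) =
      (\<Sum>\<xi>\<in>P. (cmod (fourier (\<lambda>d. diff_count (sphere a) d) \<xi>))\<^sup>2)"
    by (simp add: fourier_diff_count norm_power power_mult[symmetric] del: of_real_power)
  also have "\<dots> = real (p ^ 2 * (\<Sum>d\<in>P. (diff_count (sphere a) d)\<^sup>2))"
    by (simp add: plancherel)
  also have "\<dots> \<le> real (p ^ 2 * (3 * (card (sphere a))\<^sup>2))"
    using energy_sphere[OF a] by (intro of_nat_mono mult_left_mono) auto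
  finally show ?thesis by (simp add: mult_ac)
qed

section \<open>The exponential sum over the sphere\<close>

text \<open>The adjoint of a rotation is a rotation, which permutes the sphere.\<close>

lemma expsum_rotate:
  assumes u: "u \<in> sphere 1"
  shows "expsum (sphere a) (red (gmul u \<xi>)) = expsum (sphere a) \<xi>"
proof -
  let ?T = "\<lambda>s. red (gmul (gcnj u) s)"
  have cu: "q dvd nrm u - 1" using u by (auto simp: sphere_def)
  have maps: "?T s \<in> sphere a" if "s \<in> sphere a" for s
  proof -
    have "q dvd nrm s - a" using that by (auto simp: sphere_def)
    then have "q dvd (nrm u - 1) * nrm s + (nrm s - a)" using cu by simp
    then show ?thesis by (simp add: red_in_sphere_iff nrm_gmul algebra_simps) (simp add: nrm_def gcnj_def algebra_simps)
  qed
  have "inj_on ?T (sphere a)"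
  proof (rule inj_onI)
    fix s t assume st: "s \<in> sphere a" "t \<in> sphere a" "?T s = ?T t"
    obtain c d where [simp]: "u = (c, d)" by force
    obtain s1 s2 where [simp]: "s = (s1, s2)" by force
    obtain t1 t2 where [simp]: "t = (t1, t2)" by force
    have 1: "q dvd (c * s1 + d * s2) - (c * t1 + d * t2)" "q dvd (c * s2 - d * s1) - (c * t2 - d * t1)"
      using st by (auto simp: red_eq_iff gmul_def gcnj_def algebra_simps)
    \<comment> \<open>Multiply the difference of the two images by \<open>u\<close>, which undoes the rotation.\<close>
    have "q dvd c * ((c * s1 + d * s2) - (c * t1 + d * t2)) - d * ((c * s2 - d * s1) - (c * t2 - d * t1)) - (nrm u - 1) * (s1 - t1)"
      using 1 cu by simp
    also have "\<dots> = s1 - t1" by (simp add: nrm_def power2_eq_square algebra_simps)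
    finally have 2: "q dvd s1 - t1" .
    have "q dvd d * ((c * s1 + d * s2) - (c * t1 + d * t2)) + c * ((c * s2 - d * s1) - (c * t2 - d * t1)) - (nrm u - 1) * (s2 - t2)"
      using 1 cu by simp
    also have "\<dots> = s2 - t2" by (simp add: nrm_def power2_eq_square algebra_simps)
    finally have "red s = red t" using 2 by (simp add: red_eq_iff)
    then show "s = t" using st sphere_subset by (metis red_id subsetD)
  qed
  then have bij: "bij_betw ?T (sphere a) (sphere a)"
    using maps endo_inj_surj[of "sphere a" ?T] by (simp add: bij_betw_def image_subset_iff)
  have "expsum (sphere a) (red (gmul u \<xi>)) = (\<Sum>s\<in>sphere a. e (dot \<xi> (?T s)))"
    by (simp add: expsum_def e_dot_red dot_gmul)
  also have "\<dots> = expsum (sphere a) \<xi>"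
    using sum.reindex_bij_betw[OF bij, of "\<lambda>s. e (dot \<xi> s)"] by (simp add: expsum_def)
  finally show ?thesis .
qed

text \<open>The value at \<open>\<xi>\<close> occurs in the fourth moment once for each rotation.\<close>

lemma expsum_sphere_pow4:
  assumes a: "\<not> q dvd a" and \<xi>: "red \<xi> \<noteq> 0"
  shows "card (sphere 1) * cmod (expsum (sphere a) \<xi>) ^ 4 \<le> 3 * p ^ 2 * (card (sphere a))\<^sup>2"
proof -
  let ?O = "(\<lambda>u. red (gmul u \<xi>)) ` sphere 1"
  have inj: "inj_on (\<lambda>u. red (gmul u \<xi>)) (sphere 1)"
    using rotation_free \<xi> by (blast intro: inj_onI)
  have "card (sphere 1) * cmod (expsum (sphere a) \<xi>) ^ 4 = (\<Sum>\<eta>\<in>?O. cmod (expsum (sphere a) \<eta>) ^ 4)"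
    by (simp add: sum.reindex[OF inj] expsum_rotate)
  also have "\<dots> \<le> (\<Sum>\<eta>\<in>P. cmod (expsum (sphere a) \<eta>) ^ 4)"
    by (intro sum_mono2) auto
  finally show ?thesis using fourth_moment[OF a] by linarith
qed

text \<open>The rational parametrization \<open>t \<mapsto> ((1 - t\<^sup>2) / (1 + t\<^sup>2), 2 * t / (1 + t\<^sup>2))\<close> of the unit circle is
  injective, and at most two values of \<open>t\<close> make the denominator vanish.\<close>

lemma card_sphere_1: "p - 2 \<le> card (sphere 1)"
proof -
  \<comment> \<open>The denominator, as a general quadratic for the bound on its number of roots.\<close>
  let ?Z = "{t \<in> {0..<q}. q dvd 1 * t\<^sup>2 + 0 * t + 1}"
  let ?T = "{0..<q} - ?Z"
  have "card ?Z \<le> 2" using p_gt_2 by (intro quadratic_roots_le_2) auto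
  moreover have "finite ?Z" by (rule finite_subset[of _ "{0..<q}"]) auto
  then have "card ?T = p - card ?Z" by (subst card_Diff_subset) auto
  ultimately have "p - 2 \<le> card ?T" by linarith
  have "\<exists>w. q dvd w * (t\<^sup>2 + 1) - 1" if "t \<in> ?T" for t
  proof -
    have "\<not> q dvd t\<^sup>2 + 1" using that by auto
    then have "coprime (t\<^sup>2 + 1) q"
      using prime_q by (metis coprime_commute prime_imp_coprime)
    then obtain w where "[(t\<^sup>2 + 1) * w = 1] (mod q)" using cong_solve_coprime_int by blast
    then show ?thesis by (auto simp: cong_iff_dvd_diff mult.commute)
  qed
  then have "\<forall>t. \<exists>w. t \<in> ?T \<longrightarrow> q dvd w * (t\<^sup>2 + 1) - 1" by blast
  then obtain w where "\<forall>t. t \<in> ?T \<longrightarrow> q dvd w t * (t\<^sup>2 + 1) - 1" by (rule choice[THEN exE])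
  then have w: "q dvd w t * (t\<^sup>2 + 1) - 1" if "t \<in> ?T" for t using that by blast
  \<comment> \<open>\<open>w t\<close> is the inverse of \<open>1 + t\<^sup>2\<close>.\<close>
  define h where "h t = red ((1 - t\<^sup>2) * w t, 2 * t * w t)" for t
  note \<open>p - 2 \<le> card ?T\<close>
  also have "card ?T \<le> card (sphere 1)"
  proof (rule card_inj_on_le[of h])
    show "h ` ?T \<subseteq> sphere 1"
    proof (rule image_subsetI)
      fix t assume t: "t \<in> ?T"
      then have "q dvd (w t * (t\<^sup>2 + 1) - 1) * (w t * (t\<^sup>2 + 1) + 1)" using w[of t] by auto
      also have "\<dots> = nrm ((1 - t\<^sup>2) * w t, 2 * t * w t) - 1"
        by (simp add: nrm_def power2_eq_square algebra_simps)
      finally show "h t \<in> sphere 1" by (simp add: h_def red_in_sphere_iff)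
    qed
    show "inj_on h ?T"
    proof (rule inj_onI)
      fix t t' assume t: "t \<in> ?T" "t' \<in> ?T" "h t = h t'"
      note wt = w[OF t(1)] w[OF t(2)]
      have 1: "q dvd (1 - t\<^sup>2) * w t - (1 - t'\<^sup>2) * w t'" and 2: "q dvd 2 * t * w t - 2 * t' * w t'"
        using t(3) by (auto simp: h_def red_eq_iff)
      \<comment> \<open>The first coordinate is \<open>2 * w t - 1\<close>, so it determines \<open>w t\<close>.\<close>
      have "q dvd ((1 - t\<^sup>2) * w t - (1 - t'\<^sup>2) * w t') + (w t * (t\<^sup>2 + 1) - 1) - (w t' * (t'\<^sup>2 + 1) - 1)"
        using dvd_diff[OF dvd_add[OF 1 wt(1)] wt(2)] .
      also have "\<dots> = 2 * (w t - w t')" by (simp add: algebra_simps)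
      finally have ww: "q dvd w t - w t'" using not_dvd_2 q_dvd_mult_iff by blast
      have "q dvd (2 * t * w t - 2 * t' * w t') - 2 * t' * (w t - w t')" using 2 ww by simp
      also have "\<dots> = 2 * (w t * (t - t'))" by (simp add: algebra_simps)
      finally have "q dvd w t \<or> q dvd t - t'" using not_dvd_2 by (simp add: q_dvd_mult_iff)
      moreover have "\<not> q dvd w t"
      proof
        assume "q dvd w t"
        then have "q dvd w t * (t\<^sup>2 + 1)" by simp
        from dvd_diff[OF this wt(1)] have "q dvd 1" by simp
        then show False using p_gt_2 by simp
      qed
      ultimately show "t = t'" using t int_eq_if_dvd_diff by blast
    qed
  qed auto
  finally show ?thesis .
qed

text \<open>Pigeonhole: there are \<open>(p + 1) / 2\<close> squares \<open>x\<^sup>2\<close> and as many residues \<open>a - y\<^sup>2\<close>, so some two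
  coincide.\<close>

lemma sphere_nonempty: "sphere a \<noteq> {}"
proof -
  define H where "H = {0..(q - 1) div 2}"
  have odd: "odd q" using prime_odd_nat[OF prime_p p_gt_2] by simp
  have inj: "x = y" if "x \<in> H" "y \<in> H" "q dvd x\<^sup>2 - y\<^sup>2" for x y
  proof -
    have xy: "0 \<le> x" "0 \<le> y" "x + y < q" "x \<in> {0..<q}" "y \<in> {0..<q}" using that p_gt_2 by (auto simp: H_def)
    have "x\<^sup>2 - y\<^sup>2 = (x - y) * (x + y)" by (simp add: power2_eq_square algebra_simps)
    then have "q dvd x - y \<or> q dvd x + y" using that by (simp add: q_dvd_mult_iff)
    then show ?thesis
    proof
      assume "q dvd x - y"
      then show ?thesis using xy int_eq_if_dvd_diff by blast
    next
      assume "q dvd x + y"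
      then have "x + y = 0" using xy zdvd_not_zless[of "x + y" q] by linarith
      then show ?thesis using xy by linarith
    qed
  qed
  let ?X = "(\<lambda>x. x\<^sup>2 mod q) ` H" and ?Y = "(\<lambda>y. (a - y\<^sup>2) mod q) ` H"
  have cH: "2 * card H = p + 1" using odd by (auto simp: H_def elim!: oddE)
  have "inj_on (\<lambda>x. x\<^sup>2 mod q) H"
    by (rule inj_onI) (auto simp: mod_eq_dvd_iff intro: inj)
  then have cX: "card ?X = card H" by (rule card_image)
  have "inj_on (\<lambda>y. (a - y\<^sup>2) mod q) H"
    by (rule inj_onI) (auto simp: mod_eq_dvd_iff intro: inj[symmetric])
  then have cY: "card ?Y = card H" by (rule card_image)
  have "?X \<inter> ?Y \<noteq> {}"
  proof
    assume "?X \<inter> ?Y = {}"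
    then have "card (?X \<union> ?Y) = p + 1" using cX cY cH by (subst card_Un_disjoint) (auto simp: H_def)
    moreover have "card (?X \<union> ?Y) \<le> card {0..<q}"
      using p_pos by (intro card_mono) auto
    ultimately show False by simp
  qed
  then obtain x y where "x\<^sup>2 mod q = (a - y\<^sup>2) mod q" by auto
  then have "q dvd nrm (x, y) - a" by (simp add: mod_eq_dvd_iff nrm_def algebra_simps)
  then have "red (x, y) \<in> sphere a" by (simp add: red_in_sphere_iff)
  then show ?thesis by blast
qed

text \<open>The rotations move any one point of the sphere to pairwise distinct points.\<close>

lemma card_sphere_ge:
  assumes a: "\<not> q dvd a"
  shows "card (sphere 1) \<le> card (sphere a)"
proof -
  obtain x where x: "x \<in> sphere a" using sphere_nonempty by blast
  have "red x \<noteq> 0"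
  proof
    assume "red x = 0"
    then have "x = 0" using x sphere_subset by (metis red_id subsetD)
    then show False using x a by (simp add: sphere_def nrm_def)
  qed
  then have "inj_on (\<lambda>u. red (gmul u x)) (sphere 1)"
    using rotation_free by (blast intro: inj_onI)
  then show ?thesis
    by (rule card_inj_on_le) (simp_all add: gmul_in_sphere x image_subset_iff)
qed

text \<open>With \<open>m\<close> rotations, a value above \<open>n / 4\<close> would give \<open>m * n\<^sup>2 < 768 * p\<^sup>2\<close>, where
  \<open>768 = 3 * 4^4\<close>. Both \<open>m\<close> and \<open>n\<close> are at least \<open>p - 2\<close>, so this is false for large \<open>p\<close>; the
  threshold \<open>1000\<close> is a convenient round number.\<close>

lemma expsum_sphere_small:
  assumes a: "\<not> q dvd a" and \<xi>: "red \<xi> \<noteq> 0" and p: "1000 \<le> p"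
  shows "cmod (expsum (sphere a) \<xi>) \<le> card (sphere a) / 4"
proof (rule ccontr)
  assume large: "\<not> ?thesis"
  define n where "n = real (card (sphere a))"
  define m where "m = real (card (sphere 1))"
  have m: "real p - 2 \<le> m" using card_sphere_1 p by (simp add: m_def)
  have mn: "m \<le> n" using card_sphere_ge[OF a] by (simp add: m_def n_def)
  have pos: "0 < m" "0 < n" using m mn p by auto
  have "n / 4 < cmod (expsum (sphere a) \<xi>)" using large by (simp add: n_def)
  then have "(n / 4) ^ 4 < cmod (expsum (sphere a) \<xi>) ^ 4"
    using pos by (intro power_strict_mono) auto
  then have "m * (n / 4) ^ 4 < m * cmod (expsum (sphere a) \<xi>) ^ 4" using pos by simp
  also have "\<dots> \<le> 3 * real p ^ 2 * n ^ 2" using expsum_sphere_pow4[OF a \<xi>] by (simp add: m_def n_def)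
  finally have "n ^ 2 * (m * n ^ 2) < n ^ 2 * (768 * real p ^ 2)"
    by (simp add: power_divide field_simps power2_eq_square power4_eq_xxxx)
  then have 1: "m * n ^ 2 < 768 * real p ^ 2" using pos by (simp add: mult_less_cancel_left_pos)
  have "(real p - 2) * (real p - 2) ^ 2 \<le> m * n ^ 2"
    using m mn p by (intro mult_mono power_mono) auto
  moreover have "768 * real p ^ 2 \<le> (real p - 2) * (real p - 2) ^ 2"
  proof -
    have "998 * (real p - 2) ^ 2 \<le> (real p - 2) * (real p - 2) ^ 2"
      using p by (intro mult_right_mono) auto
    moreover have "998 * (real p - 2) ^ 2 - 768 * real p ^ 2 = real p * (230 * real p - 3992) + 3992"
      by (simp add: power2_eq_square algebra_simps)
    moreover have "0 \<le> real p * (230 * real p - 3992)" using p by (intro mult_nonneg_nonneg) auto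
    ultimately show ?thesis by linarith
  qed
  ultimately show False using 1 by linarith
qed


section \<open>Correlations along affine images of the sphere\<close>

text \<open>Moving the linear part of \<open>h\<close> to the other side of the pairing replaces \<open>\<xi>\<close> by its image \<open>\<eta>\<close>
  under the transpose. If \<open>\<eta>\<close> were zero, the character \<open>\<xi>\<close> would be constant on the image of \<open>h\<close>,
  which is the whole plane.\<close>

lemma expsum_affine_small:
  assumes a: "\<not> q dvd a" and p: "1000 \<le> p"
    and h: "\<And>x. x \<in> P \<Longrightarrow> h x = red (m11 * fst x + m12 * snd x + v1, m21 * fst x + m22 * snd x + v2)"
    and surj: "P \<subseteq> h ` P" and \<xi>: "\<xi> \<in> P" "\<xi> \<noteq> 0"
  shows "cmod (\<Sum>s\<in>sphere a. e (dot \<xi> (h s))) \<le> card (sphere a) / 4"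
proof -
  define \<eta> where "\<eta> = (fst \<xi> * m11 + snd \<xi> * m21, fst \<xi> * m12 + snd \<xi> * m22)"
  have eh: "e (dot \<xi> (h x)) = e (dot \<xi> (v1, v2)) * e (dot \<eta> x)" if "x \<in> P" for x
    using that by (simp add: h e_dot_red e_add[symmetric]) (simp add: dot_def \<eta>_def algebra_simps)
  have "red \<eta> \<noteq> 0"
  proof
    assume 0: "red \<eta> = 0"
    have "e (dot \<eta> x) = 1" for x
      using 0 by (simp add: e_eq_1_iff dot_def red_eq_0_iff)
    then have const: "e (dot \<xi> y) = e (dot \<xi> (v1, v2))" if "y \<in> P" for y
      using that surj eh by auto
    have mem: "(1, 0) \<in> P" "(0, 1) \<in> P" using p_gt_2 by (auto simp: P_def)
    have "e (dot \<xi> (v1, v2)) = 1" using const[OF zero_in_P] by (simp add: dot_def)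
    then have "e (dot \<xi> (1, 0)) = 1" "e (dot \<xi> (0, 1)) = 1"
      using const[OF mem(1)] const[OF mem(2)] by simp_all
    then have "q dvd fst \<xi>" "q dvd snd \<xi>" by (simp_all add: dot_def e_eq_1_iff)
    then have "red \<xi> = 0" by (simp add: red_eq_0_iff)
    then show False using \<xi> by (simp add: red_id)
  qed
  have "(\<Sum>s\<in>sphere a. e (dot \<xi> (h s))) = (\<Sum>s\<in>sphere a. e (dot \<xi> (v1, v2)) * e (dot \<eta> s))"
    using eh sphere_subset by (intro sum.cong) auto
  also have "\<dots> = e (dot \<xi> (v1, v2)) * expsum (sphere a) \<eta>"
    by (simp add: expsum_def sum_distrib_left)
  finally show ?thesis
    using expsum_sphere_small[OF a \<open>red \<eta> \<noteq> 0\<close> p] by (simp add: norm_mult)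
qed

lemma sphere_correlation_affine:
  assumes "\<not> q dvd a" "1000 \<le> p"
    and "\<And>x. x \<in> P \<Longrightarrow> h x = red (m11 * fst x + m12 * snd x + v1, m21 * fst x + m22 * snd x + v2)"
    and "P \<subseteq> h ` P" and f: "\<And>x. f x = 1 \<or> f x = - 1"
  shows "- (card (sphere a) / 4 * (real p)\<^sup>2) \<le> (\<Sum>s\<in>sphere a. \<Sum>x\<in>P. f x * f (red (x + h s)))"
proof -
  have "(f x)\<^sup>2 = 1" for x using f[of x] by auto
  then have "(\<Sum>x\<in>P. (f x)\<^sup>2) = (real p)\<^sup>2" by (simp add: card_P)
  moreover have "- (card (sphere a) / 4) * (\<Sum>x\<in>P. (f x)\<^sup>2) \<le>
      (\<Sum>s\<in>sphere a. \<Sum>x\<in>P. f x * f (red (x + h s)))"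
  proof (rule correlation_lower_bound[OF finite_sphere])
    show "cmod (\<Sum>s\<in>sphere a. e (dot \<xi> (h s))) \<le> card (sphere a) / 4"
      if "\<xi> \<in> P" "\<xi> \<noteq> 0" for \<xi>
      using expsum_affine_small[of a h m11 m12 v1 m21 m22 v2 \<xi>] assms(1-4) that by blast
  qed simp
  ultimately show ?thesis by simp
qed

lemma bij_betw_translate: "bij_betw (\<lambda>x. red (x + w)) P P"
  by (rule bij_betw_byWitness[where f' = "\<lambda>x. red (x - w)"])
    (auto simp: red_add red_diff red_id)

text \<open>In the third pair both points move with \<open>s\<close>; substituting \<open>x - s\<close> for \<open>x\<close> turns it into a
  correlation along \<open>g - I\<close>, whose bijectivity is needed here.\<close>

lemma monochromatic_triple:
  assumes a: "\<not> q dvd a" and p: "1000 \<le> p"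
    and g: "\<And>x. x \<in> P \<Longrightarrow> g x = red (m11 * fst x + m12 * snd x + v1, m21 * fst x + m22 * snd x + v2)"
    and surj: "P \<subseteq> g ` P" "P \<subseteq> (\<lambda>x. red (g x - x)) ` P"
  shows "\<exists>x\<in>P. \<exists>s\<in>sphere a. (x \<in> A \<longleftrightarrow> red (x + s) \<in> A) \<and> (x \<in> A \<longleftrightarrow> red (x + g s) \<in> A)"
proof (rule ccontr)
  assume none: "\<not> ?thesis"
  define f :: "int \<times> int \<Rightarrow> real" where "f x = (if x \<in> A then 1 else - 1)" for x
  have f: "f x = 1 \<or> f x = - 1" for x by (simp add: f_def)
  define n where "n = real (card (sphere a))"
  have n: "0 < n" using sphere_nonempty[of a] by (simp add: n_def card_gt_0_iff)
  let ?C = "\<lambda>h. \<Sum>s\<in>sphere a. \<Sum>x\<in>P. f x * f (red (x + h s))"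
  have "- (n / 4 * (real p)\<^sup>2) \<le> ?C (\<lambda>s. s)" unfolding n_def
    by (rule sphere_correlation_affine[OF a p, of _ 1 0 0 0 1 0]) (simp_all add: red_id f)
  moreover have "- (n / 4 * (real p)\<^sup>2) \<le> ?C g" unfolding n_def
    by (rule sphere_correlation_affine[OF a p g surj(1) f])
  moreover have "- (n / 4 * (real p)\<^sup>2) \<le> ?C (\<lambda>s. red (g s - s))" unfolding n_def
  proof (rule sphere_correlation_affine[OF a p _ surj(2) f])
    fix x assume "x \<in> P"
    then show "red (g x - x) = red ((m11 - 1) * fst x + m12 * snd x + v1, m21 * fst x + (m22 - 1) * snd x + v2)"
      by (simp add: g red_diff) (simp add: red_eq_iff algebra_simps)
  qed
  moreover have "?C (\<lambda>s. red (g s - s)) = (\<Sum>s\<in>sphere a. \<Sum>x\<in>P. f (red (x + s)) * f (red (x + g s)))"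
  proof (rule sum.cong[OF refl])
    fix s assume "s \<in> sphere a"
    have "(\<Sum>x\<in>P. f x * f (red (x + red (g s - s)))) =
        (\<Sum>x\<in>P. f (red (x + s)) * f (red (red (x + s) + red (g s - s))))"
      by (rule sum.reindex_bij_betw[OF bij_betw_translate, symmetric])
    then show "(\<Sum>x\<in>P. f x * f (red (x + red (g s - s)))) =
        (\<Sum>x\<in>P. f (red (x + s)) * f (red (x + g s)))"
      by (simp add: red_add add.assoc)
  qed
  moreover have "?C (\<lambda>s. s) + ?C g + (\<Sum>s\<in>sphere a. \<Sum>x\<in>P. f (red (x + s)) * f (red (x + g s))) =
      (\<Sum>s\<in>sphere a. \<Sum>x\<in>P. - 1)"
    unfolding sum.distrib[symmetric]
  proof (intro sum.cong refl)
    fix s x assume "s \<in> sphere a" "x \<in> P"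
    then have "\<not> ((x \<in> A \<longleftrightarrow> red (x + s) \<in> A) \<and> (x \<in> A \<longleftrightarrow> red (x + g s) \<in> A))"
      using none by blast
    then show "f x * f (red (x + s)) + f x * f (red (x + g s)) + f (red (x + s)) * f (red (x + g s)) = - 1"
      by (auto simp: f_def)
  qed
  moreover have "(\<Sum>s\<in>sphere a. \<Sum>x\<in>P. - 1) = - (n * (real p)\<^sup>2)"
    by (simp add: n_def card_P)
  ultimately have "n * (real p)\<^sup>2 \<le> 3 / 4 * (n * (real p)\<^sup>2)" by simp
  moreover have "0 < n * (real p)\<^sup>2" using n p_pos by simp
  ultimately show False by simp
qed

section \<open>Translation to the residue ring\<close>

lemma carrier_GF: "carrier (GF p) = {0..<q}"
  by (auto simp: residue_ring_def)

lemma plane_GF: "plane (GF p) = P"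
  by (simp add: plane_def P_def carrier_GF)

lemma plane_add_GF: "plane_add (GF p) x y = red (x + y)"
  by (simp add: plane_add_def red_def residue_ring_def)

lemma plane_minus_GF: "plane_minus (GF p) x y = red (x - y)"
proof -
  have "residues q" using p_gt_2 by unfold_locales simp
  then show ?thesis
    by (simp add: plane_minus_def red_def a_minus_def residues.res_neg_eq residues.res_add_eq mod_simps)
qed

lemma plane_sphere_GF:
  assumes "a \<in> carrier (GF p)"
  shows "plane_sphere (GF p) a = sphere a"
proof -
  have "a mod q = a" using assms by (simp add: carrier_GF)
  then have "nrm x mod q = a \<longleftrightarrow> q dvd nrm x - a" for x
    by (metis mod_eq_dvd_iff)
  moreover have "sq_norm (GF p) x = nrm x mod q" for x
    by (simp add: sq_norm_def residue_ring_def mod_simps nrm_def power2_eq_square)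
  ultimately show ?thesis by (simp add: plane_sphere_def sphere_def plane_GF)
qed

end

theorem theorem3:
  shows "\<exists>p0::nat. \<forall>p::nat. prime p \<and> p \<ge> p0 \<longrightarrow>
    (\<forall>g. affine_map (GF p) g \<and> invertible_on_plane (GF p) g \<and>
         invertible_on_plane (GF p) (\<lambda>x. plane_minus (GF p) (g x) x) \<longrightarrow>
      (\<forall>A B. two_coloring (plane (GF p)) A B \<longrightarrow>
        (\<forall>a\<in>carrier (GF p). a \<noteq> \<zero>\<^bsub>GF p\<^esub> \<longrightarrow>
          (\<exists>x\<in>plane (GF p). \<exists>s\<in>plane_sphere (GF p) a.
            monochromatic A B {x, plane_add (GF p) x s, plane_add (GF p) x (g s)}))))"
proof (intro exI[of _ 1000] allI impI ballI, elim conjE)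
  fix p :: nat and g A B a
  assume p: "prime p" "1000 \<le> p" and aff: "affine_map (GF p) g"
    and inv: "invertible_on_plane (GF p) g"
      "invertible_on_plane (GF p) (\<lambda>x. plane_minus (GF p) (g x) x)"
    and col: "two_coloring (plane (GF p)) A B"
    and a: "a \<in> carrier (GF p)" "a \<noteq> \<zero>\<^bsub>GF p\<^esub>"
  interpret prime_plane p using p by unfold_locales auto
  have "a \<noteq> 0" using a by (simp add: residue_ring_def)
  then have na: "\<not> q dvd a" using a zdvd_not_zless[of a q] by (auto simp: carrier_GF)
  obtain m11 m12 m21 m22 v where "\<forall>x\<in>plane (GF p). g x = plane_add (GF p)
          (m11 \<otimes>\<^bsub>GF p\<^esub> fst x \<oplus>\<^bsub>GF p\<^esub> m12 \<otimes>\<^bsub>GF p\<^esub> snd x,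
           m21 \<otimes>\<^bsub>GF p\<^esub> fst x \<oplus>\<^bsub>GF p\<^esub> m22 \<otimes>\<^bsub>GF p\<^esub> snd x) v"
    using aff unfolding affine_map_def by blast
  then have g: "g x = red (m11 * fst x + m12 * snd x + fst v, m21 * fst x + m22 * snd x + snd v)"
    if "x \<in> P" for x
    using that by (simp add: plane_GF plane_add_GF) (simp add: residue_ring_def red_def mod_simps)
  have "g ` P = P" "(\<lambda>x. red (g x - x)) ` P = P"
    using inv by (simp_all add: invertible_on_plane_def bij_betw_def plane_GF plane_minus_GF)
  then have "\<exists>x\<in>P. \<exists>s\<in>sphere a. (x \<in> A \<longleftrightarrow> red (x + s) \<in> A) \<and> (x \<in> A \<longleftrightarrow> red (x + g s) \<in> A)"
    by (intro monochromatic_triple[OF na p(2) g]) simp_all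
  then obtain x s where x: "x \<in> P" and s: "s \<in> sphere a"
    and "x \<in> A \<longleftrightarrow> red (x + s) \<in> A" "x \<in> A \<longleftrightarrow> red (x + g s) \<in> A"
    by blast
  moreover have "P \<subseteq> A \<union> B" using col by (simp add: two_coloring_def plane_GF)
  ultimately have "monochromatic A B {x, red (x + s), red (x + g s)}"
    unfolding monochromatic_def using red_in_P[of "x + s"] red_in_P[of "x + g s"] by blast
  then show "\<exists>x\<in>plane (GF p). \<exists>s\<in>plane_sphere (GF p) a.
      monochromatic A B {x, plane_add (GF p) x s, plane_add (GF p) x (g s)}"
    using x s a by (auto simp: plane_GF plane_add_GF plane_sphere_GF)
qed

end
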